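(* If a centrally symmetric convex spherical domain on the unit sphere $S^d$ is covered with a set of zones of total width $w$, then it can be covered with one zone of width $w$. In particular, the total width of zones covering a cap of spherical radius $r$ is at least $2r$.
   Context: $S^d$ is the unit $d$-sphere in $\mathbb{R}^{d+1}$ centered at the origin; the spherical distance between two points is the angle between them as unit vectors. A great sphere is the intersection of $S^d$ with a hyperplane passing through the origin (a great circle when $d=2$). A zone of width $\omega$ on $S^d$ is the set of points within spherical distance $\omega/2$ of a given great sphere. A cap of spherical radius $r$ on $S^d$ is the set of points within spherical distance $r$ of a given point on the sphere. A convex spherical domain is a domain on the sphere any two points of which can be joined by an arc of a great circle lying in the domain. A spherical domain $W$ is centrally symmetric with respect to a point $c$ if for every $a\in W$ there is $b\in W$ such that $c$ is the middle point of the shortest arc connecting $a$ and $b$; it is centrally symmetric if this holds for some point $c$.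
   Formalization: The cap radius is restricted to r ≤ π/2, since for larger r one zone of width π covers the whole sphere while π < 2r; the set of zones is assumed countable, since otherwise all great spheres, as zones of width 0, would cover the sphere with total width 0. *)

theory Defs
  imports "HOL-Analysis.Analysis"
begin

text \<open>The sphere \<open>S\<^sup>d\<close> is \<^term>\<open>sphere 0 1\<close> in a Euclidean space of dimension \<open>d + 1\<close>.
  The following functions are only meant to be applied to points of this sphere.\<close>

definition sph_dist :: "'a::euclidean_space \<Rightarrow> 'a \<Rightarrow> real" where
  "sph_dist x y = arccos (x \<bullet> y)"

definition great_sphere :: "'a::euclidean_space set \<Rightarrow> bool" where
  "great_sphere G \<longleftrightarrow> (\<exists>n. n \<noteq> 0 \<and> G = sphere 0 1 \<inter> {x. n \<bullet> x = 0})"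

text \<open>The great sphere and the width are kept as data, because they are not determined by the
  set of points: every zone of width at least \<open>\<pi>\<close> is the whole sphere.\<close>

definition zone :: "'a::euclidean_space set \<Rightarrow> real \<Rightarrow> 'a set" where
  "zone G \<omega> = {x \<in> sphere 0 1. \<exists>y\<in>G. sph_dist x y \<le> \<omega> / 2}"

definition cap :: "'a::euclidean_space \<Rightarrow> real \<Rightarrow> 'a set" where
  "cap c r = {x \<in> sphere 0 1. sph_dist c x \<le> r}"

text \<open>Unit speed parametrization of the great circle through \<open>a\<close> with unit tangent vector \<open>v\<close>
  at \<open>a\<close>, so that the parameter is the arc length.\<close>

definition gc_point :: "'a::euclidean_space \<Rightarrow> 'a \<Rightarrow> real \<Rightarrow> 'a" where
  "gc_point a v t = cos t *\<^sub>R a + sin t *\<^sub>R v"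

text \<open>The arc of length \<open>l\<close> starting at \<open>a\<close> in direction \<open>v\<close> is the image of \<open>{0..l}\<close> under
  \<^term>\<open>gc_point a v\<close>; the predicate says that it ends at \<open>b\<close>. The degenerate arc
  \<open>a = b\<close>, \<open>l = 0\<close> is allowed.\<close>

definition gc_arc :: "'a::euclidean_space \<Rightarrow> 'a \<Rightarrow> 'a \<Rightarrow> real \<Rightarrow> bool" where
  "gc_arc a b v l \<longleftrightarrow> norm v = 1 \<and> a \<bullet> v = 0 \<and> 0 \<le> l \<and> l < 2 * pi \<and> gc_point a v l = b"

definition sph_convex :: "'a::euclidean_space set \<Rightarrow> bool" where
  "sph_convex W \<longleftrightarrow> W \<subseteq> sphere 0 1 \<and>
     (\<forall>a\<in>W. \<forall>b\<in>W. \<exists>v l. gc_arc a b v l \<and> gc_point a v ` {0..l} \<subseteq> W)"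

text \<open>A connecting arc is shortest iff its length is the spherical distance of its endpoints.
  Antipodal \<open>a\<close> and \<open>b\<close> have many shortest connecting arcs; \<open>c\<close> has to be the middle point of
  one of them. Thus a closed hemisphere is centrally symmetric with respect to its center.\<close>

definition sph_symmetric_about :: "'a::euclidean_space \<Rightarrow> 'a set \<Rightarrow> bool" where
  "sph_symmetric_about c W \<longleftrightarrow>
     (\<forall>a\<in>W. \<exists>b\<in>W. \<exists>v. gc_arc a b v (sph_dist a b) \<and> c = gc_point a v (sph_dist a b / 2))"

definition sph_centrally_symmetric :: "'a::euclidean_space set \<Rightarrow> bool" where
  "sph_centrally_symmetric W \<longleftrightarrow> (\<exists>c\<in>sphere 0 1. sph_symmetric_about c W)"

end

theory Submission
  imports Defs
begin

text \<open>Finitely many zones of total width less than \<open>\<pi>\<close> miss a point of the sphere: by the polynomial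
  method of Glazyrin, Karasev and Polyanskii, a maximum point of a suitable product of affine
  functions is far from all its zeros. If zones cover a cap of radius \<open>r\<close>, then they also cover the
  opposite cap, and one more zone of width \<open>\<pi> - 2 r\<close> completes a covering of the sphere. Finally, if
  a symmetric convex \<open>W\<close> contains no cap around its center \<open>c\<close> of radius greater than \<open>r\<close>, then a
  supporting hyperplane of the cone over \<open>W\<close>, together with its reflection in \<open>c\<close>, confines \<open>W\<close> to
  a zone of width \<open>2 r\<close>.\<close>

section \<open>Trigonometric polynomials and the number of their zeros\<close>

text \<open>A real trigonometric polynomial of degree at most \<open>n\<close> is a Laurent
  polynomial in \<open>cis t\<close>. The factor \<open>cis t ^ n\<close> clears the negative
  powers, so products and zeros reduce to ordinary polynomials.\<close>

definition trig_poly :: "nat \<Rightarrow> (real \<Rightarrow> real) \<Rightarrow> bool" where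
  "trig_poly n f \<longleftrightarrow>
     (\<exists>p. degree p \<le> 2 * n \<and> (\<forall>t. complex_of_real (f t) * cis t ^ n = poly p (cis t)))"

lemma trig_poly_mult:
  assumes "trig_poly m f" "trig_poly n g"
  shows "trig_poly (m + n) (\<lambda>t. f t * g t)"
proof -
  obtain p q where "degree p \<le> 2 * m" "degree q \<le> 2 * n"
    and "\<And>t. complex_of_real (f t) * cis t ^ m = poly p (cis t)"
    and "\<And>t. complex_of_real (g t) * cis t ^ n = poly q (cis t)"
    using assms unfolding trig_poly_def by blast
  then show ?thesis
    unfolding trig_poly_def
    by (intro exI[of _ "p * q"])
      (auto simp: power_add algebra_simps simp flip: \<open>\<And>t. _ = poly p (cis t)\<close> \<open>\<And>t. _ = poly q (cis t)\<close>
        intro!: order_trans[OF degree_mult_le])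
qed

lemma trig_poly_linear_combination:
  assumes "trig_poly n f" "trig_poly n g"
  shows "trig_poly n (\<lambda>t. a * f t + b * g t)"
proof -
  obtain p q where "degree p \<le> 2 * n" "degree q \<le> 2 * n"
    and "\<And>t. complex_of_real (f t) * cis t ^ n = poly p (cis t)"
    and "\<And>t. complex_of_real (g t) * cis t ^ n = poly q (cis t)"
    using assms unfolding trig_poly_def by blast
  then show ?thesis
    unfolding trig_poly_def
    by (intro exI[of _ "smult (of_real a) p + smult (of_real b) q"])
      (auto simp: algebra_simps simp flip: \<open>\<And>t. _ = poly p (cis t)\<close> \<open>\<And>t. _ = poly q (cis t)\<close>
        intro!: degree_add_le order_trans[OF degree_smult_le])
qed

lemma trig_poly_prod:
  assumes "finite A" "\<And>a. a \<in> A \<Longrightarrow> trig_poly 1 (f a)"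
  shows "trig_poly (card A) (\<lambda>t. \<Prod>a\<in>A. f a t)"
  using assms
proof (induction A rule: finite_induct)
  case empty
  then show ?case
    by (auto simp: trig_poly_def intro: exI[of _ 1])
next
  case (insert a A)
  then show ?case
    using trig_poly_mult[of 1 "f a" "card A" "\<lambda>t. \<Prod>a\<in>A. f a t"] by simp
qed

lemma trig_poly_cos: "trig_poly n (\<lambda>t. cos (real n * (t - s)))"
proof -
  define p where "p = monom (cis (- (n * s)) / 2) (2 * n) + [:cis (n * s) / 2:]"
  have "complex_of_real (cos (real n * (t - s))) * cis t ^ n = poly p (cis t)" for t
  proof -
    have cos_cis: "complex_of_real (cos x) = (cis x + cis (- x)) / 2" for x
      by (simp add: complex_eq_iff)
    have "complex_of_real (cos (real n * (t - s))) * cis t ^ n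
        = (cis (real n * (t - s)) * cis (n * t) + cis (- (real n * (t - s))) * cis (n * t)) / 2"
      unfolding cos_cis Complex.DeMoivre by (simp only: distrib_right times_divide_eq_left)
    also have "\<dots> = (cis (- (n * s)) * cis (2 * n * t) + cis (n * s)) / 2"
      by (simp add: cis_mult algebra_simps)
    also have "\<dots> = poly p (cis t)"
      by (simp add: p_def poly_monom Complex.DeMoivre add_divide_distrib)
    finally show ?thesis .
  qed
  moreover have "degree p \<le> 2 * n"
    unfolding p_def by (intro degree_add_le degree_monom_le) simp
  ultimately show ?thesis
    unfolding trig_poly_def by blast
qed

text \<open>Affine functions take this form on a great circle parametrized by
  \<open>gc_point\<close>.\<close>

lemma trig_poly_affine: "trig_poly 1 (\<lambda>t. a * cos t + b * sin t + c)"
proof -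
  have "complex_of_real (a * cos t + b * sin t + c) * cis t
      = poly [:Complex a b / 2, of_real c, Complex a (- b) / 2:] (cis t)" for t
  proof -
    have "sin t * sin t = 1 - cos t * cos t"
      by (metis sin_squared_eq power2_eq_square)
    then have "x * (sin t * sin t) = x - x * (cos t * cos t)" for x
      by (simp add: right_diff_distrib)
    then show ?thesis
      by (simp add: complex_eq_iff field_simps)
  qed
  then show ?thesis
    unfolding trig_poly_def
    by (intro exI[of _ "[:Complex a b / 2, of_real c, Complex a (- b) / 2:]"]) simp
qed

text \<open>On an open interval of length 2 pi, \<open>cis\<close> is injective and sends zeros to
  roots of a polynomial of degree at most \<open>2 * n\<close>; the value at \<open>t\<close> shows
  that this polynomial is nonzero.\<close>

lemma card_trig_poly_zeros:
  assumes "trig_poly n g" "g t \<noteq> 0" "Z \<subseteq> {a<..<a + 2 * pi}" "\<And>z. z \<in> Z \<Longrightarrow> g z = 0"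
  shows "card Z \<le> 2 * n"
proof -
  obtain p where p: "degree p \<le> 2 * n" "\<And>t. complex_of_real (g t) * cis t ^ n = poly p (cis t)"
    using assms unfolding trig_poly_def by blast
  have "poly p (cis t) \<noteq> 0"
    using assms(2) by (simp flip: p(2))
  then have "p \<noteq> 0" by auto
  have "inj_on cis Z"
  proof (rule inj_onI)
    fix x y assume "x \<in> Z" "y \<in> Z" "cis x = cis y"
    then obtain k :: int where k: "x = y + 2 * pi * k"
      using sin_cos_eq_iff[of x y] by (auto simp: complex_eq_iff)
    have "a < x" "x < a + 2 * pi" "a < y" "y < a + 2 * pi"
      using assms(3) \<open>x \<in> Z\<close> \<open>y \<in> Z\<close> by auto
    then have "\<bar>2 * pi * k\<bar> < 2 * pi * 1"
      using k by linarith
    then have "\<bar>real_of_int k\<bar> < 1"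
      by (simp add: abs_mult)
    then show "x = y"
      using k by simp
  qed
  then have "card Z = card (cis ` Z)"
    by (simp add: card_image)
  also have "\<dots> \<le> card {z. poly p z = 0}"
    using assms(4) poly_roots_finite[OF \<open>p \<noteq> 0\<close>] by (intro card_mono) (auto simp flip: p(2))
  also have "\<dots> \<le> 2 * n"
    using card_poly_roots_bound[OF \<open>p \<noteq> 0\<close>] p(1) by simp
  finally show ?thesis .
qed

section \<open>Sign changes and the distance from a maximum to a zero\<close>

text \<open>The intermediate value theorem gives a zero between consecutive points; the nonzero
  values there put it strictly inside, so all these zeros are distinct.\<close>

lemma sign_changes_zeros:
  fixes b :: "nat \<Rightarrow> real"
  assumes "continuous_on UNIV g" "\<And>k. k < M \<Longrightarrow> b k < b (Suc k)"
    and "\<And>k. k \<le> M \<Longrightarrow> (-1) ^ k * g (b k) > (0::real)"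
  shows "b 0 \<le> b M \<and> (\<exists>Z. finite Z \<and> card Z = M \<and> Z \<subseteq> {b 0<..<b M} \<and> (\<forall>z\<in>Z. g z = 0))"
  using assms(2,3)
proof (induction M)
  case 0
  show ?case by (auto intro: exI[of _ "{}"])
next
  case (Suc M)
  have "b 0 \<le> b M" and "\<exists>Z. finite Z \<and> card Z = M \<and> Z \<subseteq> {b 0<..<b M} \<and> (\<forall>z\<in>Z. g z = 0)"
    using Suc.IH Suc.prems by simp_all
  then obtain Z where Z: "finite Z" "card Z = M" "Z \<subseteq> {b 0<..<b M}" "\<forall>z\<in>Z. g z = 0"
    by blast
  have less: "b M < b (Suc M)" and pos: "(-1) ^ M * g (b M) > 0" "(-1) ^ Suc M * g (b (Suc M)) > 0"
    using Suc.prems(1)[of M] Suc.prems(2)[of M] Suc.prems(2)[of "Suc M"] by simp_all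
  have "\<exists>x\<ge>b M. x \<le> b (Suc M) \<and> (\<lambda>x. (-1) ^ M * g x) x = 0"
    using less pos assms(1)
    by (intro IVT2') (auto intro!: continuous_intros elim: continuous_on_subset)
  then obtain x where x: "b M \<le> x" "x \<le> b (Suc M)" "g x = 0"
    by auto
  have "x \<noteq> b M" "x \<noteq> b (Suc M)"
    using pos x(3) by force+
  then have x': "b M < x" "x < b (Suc M)"
    using x by linarith+
  have "x \<notin> Z"
    using Z(3) x' by auto
  moreover have "insert x Z \<subseteq> {b 0<..<b (Suc M)}"
    using Z(3) x' less \<open>b 0 \<le> b M\<close> by fastforce
  ultimately show ?case
    using Z(1,2,4) x(3) less \<open>b 0 \<le> b M\<close> by (intro conjI exI[of _ "insert x Z"]) simp_all
qed

text \<open>M. Riesz. Otherwise \<open>cos (n (t + \<delta>))\<close>, for small \<open>\<delta> > 0\<close>, and a slightly shrunk \<open>f\<close> agree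
  \<open>2 n + 2\<close> times within a period: once between any two consecutive extrema of the cosine, and
  two additional times around \<open>0\<close> and \<open>t\<close>.\<close>

lemma trig_poly_zero_far_from_max:
  assumes "trig_poly n f" "continuous_on UNIV f" "n \<ge> 1"
    and max: "\<And>s. \<bar>f s\<bar> \<le> \<bar>f 0\<bar>" and "f 0 \<noteq> 0" "0 < t" "t < pi / (2 * n)"
  shows "f t \<noteq> 0"
proof
  assume "f t = 0"
  define A where "A = \<bar>f 0\<bar>"
  \<comment> \<open>Half of the room left by \<open>t < pi / (2 * n)\<close>, so that
    \<open>t + \<delta>\<close> is still below the first positive zero of
    \<open>cos (n * x)\<close>.\<close>
  define \<delta> where "\<delta> = (pi / (2 * n) - t) / 2"
  \<comment> \<open>Makes \<open>cos (n * \<delta>)\<close> equal to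
    \<open>1 - 2 * \<epsilon>\<close>: at 0 the shrunk \<open>f\<close>, of size
    \<open>(1 - \<epsilon>) * A\<close>, exceeds the shifted cosine wave, yet it stays strictly
    below the amplitude \<open>A\<close> everywhere.\<close>
  define \<epsilon> where "\<epsilon> = (1 - cos (n * \<delta>)) / 2"
  define g where "g s = A * cos (real n * (s - (- \<delta>))) + (- ((1 - \<epsilon>) * sgn (f 0))) * f s" for s
  \<comment> \<open>The extrema of the wave are \<open>j * pi / n - \<delta>\<close>. Inserting the
    two points 0 and \<open>t\<close> after the first one shifts the later indices to
    \<open>k = j + 2\<close>, which keeps the parity.\<close>
  define b where "b k = (if k = 0 then - \<delta> else if k = 1 then 0 else if k = 2 then t
    else (real k - 2) * pi / n - \<delta>)" for k :: nat
  have "A > 0" using \<open>f 0 \<noteq> 0\<close> by (simp add: A_def)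
  have "n > 0" using \<open>n \<ge> 1\<close> by simp
  have "\<delta> > 0" "t + \<delta> < pi / (2 * n)"
    using \<open>t < pi / (2 * n)\<close> by (auto simp: \<delta>_def field_simps)
  have small: "n * (t + \<delta>) < pi / 2"
    using \<open>t + \<delta> < pi / (2 * n)\<close> \<open>n > 0\<close> by (simp add: field_simps)
  have "n * \<delta> > 0" using \<open>\<delta> > 0\<close> \<open>n > 0\<close> by simp
  have "n * \<delta> < n * (t + \<delta>)" using \<open>0 < t\<close> \<open>n > 0\<close> by simp
  then have "n * \<delta> < pi / 2" using small by linarith
  have "cos (n * \<delta>) < cos 0"
    using \<open>n * \<delta> > 0\<close> \<open>n * \<delta> < pi / 2\<close> pi_gt_zero by (intro cos_monotone_0_pi) linarith+
  moreover have "cos (n * \<delta>) > 0"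
    using \<open>n * \<delta> > 0\<close> \<open>n * \<delta> < pi / 2\<close> by (intro cos_gt_zero_pi) auto
  ultimately have eps: "0 < \<epsilon>" "\<epsilon> < 1" "cos (n * \<delta>) = 1 - 2 * \<epsilon>"
    by (auto simp: \<epsilon>_def field_simps)
  have "trig_poly n g"
    unfolding g_def by (intro trig_poly_linear_combination trig_poly_cos assms(1))
  have contg: "continuous_on UNIV g"
    unfolding g_def by (intro continuous_intros assms(2))
  have bound: "\<bar>(1 - \<epsilon>) * sgn (f 0) * f s\<bar> < A" for s
  proof -
    have "\<bar>(1 - \<epsilon>) * sgn (f 0) * f s\<bar> = (1 - \<epsilon>) * \<bar>f s\<bar>"
      using eps \<open>f 0 \<noteq> 0\<close> by (simp add: abs_mult abs_sgn_eq)
    also have "\<dots> \<le> (1 - \<epsilon>) * A"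
      using eps max by (intro mult_left_mono) (auto simp: A_def)
    also have "\<dots> < A"
      using eps \<open>A > 0\<close> by simp
    finally show ?thesis .
  qed
  have signs: "(-1) ^ k * g (b k) > 0" for k
  proof -
    consider "k = 0" | "k = 1" | "k = 2" | "k \<ge> 3" by linarith
    then show ?thesis
    proof cases
      case 1
      then show ?thesis using bound[of "- \<delta>"] by (simp add: b_def g_def)
    next
      case 2
      have "sgn (f 0) * f 0 = A" by (simp add: A_def sgn_mult_self_eq abs_sgn mult.commute)
      then have "g 0 = - (\<epsilon> * A)"
        by (simp add: g_def algebra_simps \<epsilon>_def)
          (simp add: field_simps)
      then show ?thesis using 2 eps \<open>A > 0\<close> by (simp add: b_def)
    next
      case 3
      have "cos (n * (t + \<delta>)) > 0"
        using small \<open>n > 0\<close> \<open>t > 0\<close> \<open>\<delta> > 0\<close>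
        by (intro cos_gt_zero_pi) (auto intro: less_trans[of _ 0])
      then show ?thesis using 3 \<open>f t = 0\<close> \<open>A > 0\<close> by (simp add: b_def g_def)
    next
      case 4
      then obtain j where j: "k = j + 2" using le_Suc_ex[of 2 k] by auto
      have "b k = j * pi / n - \<delta>" using 4 by (auto simp: b_def j)
      then have "real n * (b k - (- \<delta>)) = j * pi" using \<open>n > 0\<close> by simp
      then have "cos (real n * (b k - (- \<delta>))) = (-1) ^ j" by (simp add: mult.commute)
      then have "(-1) ^ k * g (b k) = A - (-1) ^ j * ((1 - \<epsilon>) * sgn (f 0) * f (b k))"
        by (simp add: g_def j algebra_simps flip: power_add mult_2)
      also have "\<dots> > 0"
        using bound[of "b k"] by (cases "even j") auto
      finally show ?thesis .
    qed
  qed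
  have mono: "b k < b (Suc k)" for k
  proof -
    consider "k = 0" | "k = 1" | "k = 2" | "k \<ge> 3" by linarith
    then show ?thesis
    proof cases
      case 3
      have "t + \<delta> < pi / n"
        using \<open>t + \<delta> < pi / (2 * n)\<close> pi_gt_zero \<open>n > 0\<close>
        by (elim less_trans) (simp add: field_simps)
      with 3 show ?thesis by (simp add: b_def)
    next
      case 4
      then show ?thesis using \<open>n > 0\<close> by (auto simp: b_def divide_strict_right_mono)
    qed (use \<open>\<delta> > 0\<close> \<open>t > 0\<close> in \<open>auto simp: b_def\<close>)
  qed
  obtain Z where Z: "finite Z" "card Z = 2 * n + 2" "Z \<subseteq> {b 0<..<b (2 * n + 2)}" "\<forall>z\<in>Z. g z = 0"
    using sign_changes_zeros[OF contg mono signs] by blast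
  \<comment> \<open>Thus all \<open>2 * n + 2\<close> zeros of \<open>g\<close> lie in one open
    period, where at most \<open>2 * n\<close> are possible.\<close>
  have "b (2 * n + 2) = b 0 + 2 * pi"
    using \<open>n > 0\<close> by (simp add: b_def)
  moreover have "g (b 0) \<noteq> 0" using signs[of 0] by auto
  ultimately show False
    using card_trig_poly_zeros[OF \<open>trig_poly n g\<close>, of "b 0" Z "b 0"] Z by auto
qed

section \<open>Moving along great circles\<close>

lemma norm_gc_point:
  assumes "norm x = 1" "norm q = 1" "x \<bullet> q = 0"
  shows "norm (gc_point x q t) = 1"
proof -
  have "x \<bullet> x = 1" "q \<bullet> q = 1" "q \<bullet> x = 0"
    using assms by (auto simp: norm_eq_1 inner_commute)
  then have "gc_point x q t \<bullet> gc_point x q t = cos t * cos t + sin t * sin t"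
    using assms(3) by (simp add: gc_point_def inner_simps)
  then show ?thesis
    by (simp add: norm_eq_1 flip: power2_eq_square)
qed

text \<open>The meridian from \<open>x\<close> towards the pole \<open>v\<close>: \<open>q\<close>
  is the normalized part of \<open>v\<close> orthogonal to \<open>x\<close>, and the latitude
  \<open>arcsin (v \<bullet> x)\<close> grows at unit speed. At the poles themselves no direction
  would be determined.\<close>

lemma meridian:
  assumes "norm x = 1" "norm v = 1" "\<bar>v \<bullet> x\<bar> < 1"
  obtains q where "norm q = 1" "x \<bullet> q = 0" "\<And>t. v \<bullet> gc_point x q t = sin (arcsin (v \<bullet> x) + t)"
proof -
  define l where "l = arcsin (v \<bullet> x)"
  have sin_l: "sin l = v \<bullet> x" and "- (pi / 2) < l" "l < pi / 2"
    using assms(3) arcsin_lt_bounded[of "v \<bullet> x"] by (auto simp: l_def)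
  then have "cos l > 0" by (intro cos_gt_zero_pi)
  have unit: "x \<bullet> x = 1" "v \<bullet> v = 1"
    using assms by (auto simp: norm_eq_1)
  define q where "q = (v - sin l *\<^sub>R x) /\<^sub>R cos l"
  have vx: "v \<bullet> x = sin l" "x \<bullet> v = sin l" by (simp_all add: sin_l inner_commute)
  have sq: "1 - sin l * sin l = cos l * cos l"
    using cos_squared_eq[of l] by (simp add: power2_eq_square)
  have vq: "v \<bullet> q = cos l"
    using \<open>cos l > 0\<close> by (simp add: q_def inner_simps unit vx sq)
  have xq: "x \<bullet> q = 0"
    by (simp add: q_def inner_simps unit vx)
  have "q \<bullet> q = 1"
  proof -
    have "q \<bullet> q = (v \<bullet> q - sin l * (x \<bullet> q)) / cos l"
      by (subst (1) q_def) (simp add: inner_simps divide_inverse mult.commute)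
    then show ?thesis using \<open>cos l > 0\<close> by (simp add: vq xq)
  qed
  moreover have "v \<bullet> gc_point x q t = sin (l + t)" for t
    by (simp add: gc_point_def inner_simps vx vq sin_add mult.commute)
  ultimately show thesis
    using that[of q] xq by (simp add: norm_eq_1 l_def)
qed

text \<open>Provides a point where the product of affine functions does not vanish. A point on the
  new slice is moved a little along its meridian; by continuity it stays off the earlier
  slices.\<close>

lemma exists_point_off_slices:
  fixes v :: "'i \<Rightarrow> 'a::euclidean_space"
  assumes "finite A" "\<And>a. a \<in> A \<Longrightarrow> norm (v a) = 1" "\<And>a. a \<in> A \<Longrightarrow> \<bar>s a\<bar> < 1"
  shows "\<exists>x. norm x = 1 \<and> (\<forall>a\<in>A. v a \<bullet> x \<noteq> s a)"
  using assms
proof (induction A rule: finite_induct)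
  case empty
  then show ?case by (auto intro: norm_Basis[OF SOME_Basis])
next
  case (insert a A)
  then obtain x where x: "norm x = 1" "\<forall>a\<in>A. v a \<bullet> x \<noteq> s a"
    by auto
  show ?case
  proof (cases "v a \<bullet> x = s a")
    case True
    then have "\<bar>v a \<bullet> x\<bar> < 1" using insert.prems by simp
    then obtain q where q: "norm q = 1" "x \<bullet> q = 0"
        "\<And>t. v a \<bullet> gc_point x q t = sin (arcsin (v a \<bullet> x) + t)"
      using meridian[OF x(1)] insert.prems(1) by blast
    define l where "l = arcsin (v a \<bullet> x)"
    have l: "\<bar>l\<bar> < pi / 2" "sin l = s a"
      using \<open>\<bar>v a \<bullet> x\<bar> < 1\<close> arcsin_lt_bounded[of "v a \<bullet> x"] True by (auto simp: l_def abs_less_iff)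
    have "\<forall>\<^sub>F t in at 0. v b \<bullet> gc_point x q t \<noteq> s b" if "b \<in> A" for b
    proof (rule tendsto_imp_eventually_ne)
      show "((\<lambda>t. v b \<bullet> gc_point x q t) \<longlongrightarrow> v b \<bullet> gc_point x q 0) (at 0)"
        unfolding gc_point_def by (intro tendsto_intros)
      show "v b \<bullet> gc_point x q 0 \<noteq> s b"
        using x(2) that by (simp add: gc_point_def)
    qed
    then have "\<forall>\<^sub>F t in at 0. \<forall>b\<in>A. v b \<bullet> gc_point x q t \<noteq> s b"
      using insert.hyps(1) by (simp add: eventually_ball_finite)
    \<comment> \<open>For \<open>\<bar>t\<bar> < pi / 2 - \<bar>l\<bar>\<close> the latitudes
      \<open>l\<close> and \<open>l + t\<close> both lie where the sine is injective.\<close>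
    moreover have "\<forall>\<^sub>F t in at (0::real). v a \<bullet> gc_point x q t \<noteq> s a"
      unfolding eventually_at
    proof (intro exI[of _ "pi / 2 - \<bar>l\<bar>"] conjI ballI impI)
      fix t :: real assume t: "t \<noteq> 0 \<and> dist t 0 < pi / 2 - \<bar>l\<bar>"
      then have "sin (l + t) \<noteq> sin l"
        using l(1) sin_inj_pi[of "l + t" l] by (simp add: dist_real_def) argo
      then show "v a \<bullet> gc_point x q t \<noteq> s a"
        using l(2) by (simp add: q(3) l_def)
    qed (use l in auto)
    ultimately have "\<forall>\<^sub>F t in at 0. \<forall>b\<in>insert a A. v b \<bullet> gc_point x q t \<noteq> s b"
      by eventually_elim auto
    then obtain t where "\<forall>b\<in>insert a A. v b \<bullet> gc_point x q t \<noteq> s b"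
      using eventually_happens[of _ "at (0::real)"] by force
    then show ?thesis
      using norm_gc_point[OF x(1) q(1,2)] by blast
  qed (use x in auto)
qed

section \<open>A point outside finitely many zones\<close>

text \<open>Selects the strip containing a given rescaled latitude. The floor works except at the
  right end \<open>y = m\<close>, which belongs to the last strip \<open>j = m - 1\<close>.\<close>

lemma unit_interval_cover:
  fixes y :: real
  assumes "0 \<le> y" "y \<le> real m" "m \<ge> 1"
  obtains j where "j < m" "real j \<le> y" "y \<le> real j + 1"
proof (cases "y = m")
  case True
  then show ?thesis using that[of "m - 1"] assms(3) by (simp add: of_nat_diff)
next
  case False
  have "real (nat \<lfloor>y\<rfloor>) \<le> y" "y < real (nat \<lfloor>y\<rfloor>) + 1"
    using assms(1) by (auto simp: of_nat_nat)
  then show ?thesis using that[of "nat \<lfloor>y\<rfloor>"] False assms(2) by linarith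
qed

text \<open>A zone of half-width \<open>m h\<close> is the union of the \<open>h\<close>-neighbourhoods of \<open>m\<close> parallel
  small spheres. Put such spheres into all zones, with a common \<open>h < \<pi> / (2 N)\<close>, where \<open>N\<close> is the
  number of spheres. The product of the \<open>N\<close> affine functions vanishing on them is on every great
  circle a trigonometric polynomial of degree \<open>N\<close>, so a maximum point of its absolute value is
  farther than \<open>h\<close> from all the small spheres.\<close>

lemma finitely_many_zones_miss_point:
  fixes v :: "'i \<Rightarrow> 'a::euclidean_space"
  assumes "finite J" "\<And>i. i \<in> J \<Longrightarrow> norm (v i) = 1" "\<And>i. i \<in> J \<Longrightarrow> 0 \<le> \<alpha> i" "sum \<alpha> J < pi / 2"
  shows "\<exists>x. norm x = 1 \<and> (\<forall>i\<in>J. sin (\<alpha> i) < \<bar>v i \<bullet> x\<bar>)"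
proof (cases "J = {}")
  case True
  then show ?thesis by (auto intro: norm_Basis[OF SOME_Basis])
next
  case False
  have "1 - 2 * sum \<alpha> J / pi > 0"
    using assms(4) by (simp add: field_simps)
  \<comment> \<open>With \<open>h = pi / (2 * N')\<close> this says
    \<open>sum \<alpha> J / h + card J < N'\<close>, and the left side bounds the number
    \<open>N\<close> of small spheres.\<close>
  then obtain N' :: nat where N': "real (card J) < real N' * (1 - 2 * sum \<alpha> J / pi)"
    using reals_Archimedean3 by blast
  then have "N' > 0" by (cases N') auto
  define h where "h = pi / (2 * N')"
  have "h > 0" using \<open>N' > 0\<close> by (simp add: h_def)
  define m where "m i = nat \<lfloor>\<alpha> i / h\<rfloor> + 1" for i
  have m: "\<alpha> i \<le> m i * h" "m i \<le> \<alpha> i / h + 1" if "i \<in> J" for i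
  proof -
    have "0 \<le> \<alpha> i / h" using assms(3)[OF that] \<open>h > 0\<close> by simp
    then have "real (nat \<lfloor>\<alpha> i / h\<rfloor>) \<le> \<alpha> i / h" "\<alpha> i / h < real (nat \<lfloor>\<alpha> i / h\<rfloor>) + 1"
      by auto
    then show "\<alpha> i \<le> m i * h" "m i \<le> \<alpha> i / h + 1"
      using \<open>h > 0\<close> by (auto simp: m_def field_simps)
  qed
  define A where "A = Sigma J (\<lambda>i. {..<m i})"
  define N where "N = card A"
  \<comment> \<open>Latitudes spaced by \<open>2 * h\<close> and symmetric about the equator: their
    closed \<open>h\<close>-neighbourhoods fill the range from \<open>- m i * h\<close> to
    \<open>m i * h\<close>.\<close>
  define \<beta> where "\<beta> = (\<lambda>(i, j). (2 * real j + 1 - real (m i)) * h)"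
  have "finite A" using assms(1) by (simp add: A_def)
  have "N = sum m J" using assms(1) by (simp add: N_def A_def)
  have "real N \<le> (\<Sum>i\<in>J. \<alpha> i / h + 1)"
    unfolding \<open>N = sum m J\<close> of_nat_sum using m(2) by (intro sum_mono) auto
  also have "\<dots> = sum \<alpha> J / h + card J"
    by (simp add: sum.distrib sum_divide_distrib)
  also have "\<dots> < N'"
    using N' \<open>N' > 0\<close> by (simp add: h_def field_simps)
  finally have "N < N'" by simp
  have m_le: "m i \<le> N" if "i \<in> J" for i
    unfolding \<open>N = sum m J\<close> using that assms(1) by (intro member_le_sum) auto
  have "N \<ge> 1"
    using False m_le by (force simp: m_def)
  have "h < pi / (2 * N)"
    using \<open>N < N'\<close> \<open>N \<ge> 1\<close> by (simp add: h_def field_simps)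
  have beta: "\<bar>\<beta> a\<bar> < pi / 2" if in_A: "a \<in> A" for a
  proof -
    obtain i j where a: "a = (i, j)" "i \<in> J" "j < m i" using in_A by (auto simp: A_def)
    have "\<bar>\<beta> a\<bar> = \<bar>2 * real j + 1 - real (m i)\<bar> * h"
      using \<open>h > 0\<close> by (simp add: \<beta>_def a abs_mult)
    also have "\<dots> < N' * h"
      using a m_le[OF a(2)] \<open>N < N'\<close> \<open>h > 0\<close> by (intro mult_strict_right_mono) auto
    also have "\<dots> = pi / 2"
      using \<open>N' > 0\<close> by (simp add: h_def)
    finally show ?thesis .
  qed
  define P where "P x = (\<Prod>a\<in>A. v (fst a) \<bullet> x - sin (\<beta> a))" for x
  have contP: "continuous_on S P" for S
    unfolding P_def by (intro continuous_intros)
  have "\<bar>sin (\<beta> a)\<bar> < 1" if "a \<in> A" for a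
  proof -
    have "sin (- (pi / 2)) < sin (\<beta> a)" "sin (\<beta> a) < sin (pi / 2)"
      using beta[OF that] by (intro sin_monotone_2pi; linarith)+
    then show ?thesis by (simp add: abs_less_iff)
  qed
  then obtain x0 where x0: "norm x0 = 1" "\<forall>a\<in>A. v (fst a) \<bullet> x0 \<noteq> sin (\<beta> a)"
    using exists_point_off_slices[OF \<open>finite A\<close>, of "\<lambda>a. v (fst a)" "\<lambda>a. sin (\<beta> a)"] assms(2)
    by (auto simp: A_def)
  then have "P x0 \<noteq> 0" using \<open>finite A\<close> by (auto simp: P_def)
  have "\<exists>p\<in>sphere 0 1. \<forall>x\<in>sphere 0 1. \<bar>P x\<bar> \<le> \<bar>P p\<bar>"
    using x0(1) by (intro continuous_attains_sup continuous_on_rabs contP) auto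
  then obtain p where p: "norm p = 1" "\<And>x. norm x = 1 \<Longrightarrow> \<bar>P x\<bar> \<le> \<bar>P p\<bar>"
    by auto
  have "P p \<noteq> 0"
    using p(2)[OF x0(1)] \<open>P x0 \<noteq> 0\<close> by auto
  have no_zero: "P (gc_point p q t) \<noteq> 0" if "norm q = 1" "p \<bullet> q = 0" "0 < t" "t < pi / (2 * N)" for q t
  proof (rule trig_poly_zero_far_from_max[where f = "\<lambda>t. P (gc_point p q t)"])
    have "trig_poly 1 (\<lambda>t. v (fst a) \<bullet> gc_point p q t - sin (\<beta> a))" for a
      using trig_poly_affine[of "v (fst a) \<bullet> p" "v (fst a) \<bullet> q" "- sin (\<beta> a)"]
      by (simp add: gc_point_def inner_simps mult.commute)
    then show "trig_poly N (\<lambda>t. P (gc_point p q t))"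
      unfolding P_def N_def by (intro trig_poly_prod \<open>finite A\<close>)
    show "continuous_on UNIV (\<lambda>t. P (gc_point p q t))"
      unfolding gc_point_def
      by (intro continuous_on_compose2[OF contP[of UNIV]] continuous_intros) auto
    show "\<bar>P (gc_point p q s)\<bar> \<le> \<bar>P (gc_point p q 0)\<bar>" for s
      using p norm_gc_point[OF p(1) that(1,2)] by (simp add: gc_point_def[of _ _ 0])
    show "P (gc_point p q 0) \<noteq> 0"
      using \<open>P p \<noteq> 0\<close> by (simp add: gc_point_def)
  qed (use that \<open>N \<ge> 1\<close> in auto)
  have "sin (\<alpha> i) < \<bar>v i \<bullet> p\<bar>" if iJ: "i \<in> J" for i
  proof (rule ccontr)
    assume "\<not> ?thesis"
    then have le: "\<bar>v i \<bullet> p\<bar> \<le> sin (\<alpha> i)" by simp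
    have "\<alpha> i \<le> sum \<alpha> J"
      using iJ assms(1,3) by (intro member_le_sum) auto
    then have al: "0 \<le> \<alpha> i" "\<alpha> i < pi / 2"
      using assms(3)[OF iJ] assms(4) by auto
    then have "sin (\<alpha> i) < sin (pi / 2)"
      by (intro sin_monotone_2pi) auto
    then have lt1: "\<bar>v i \<bullet> p\<bar> < 1" using le by simp
    define l where "l = arcsin (v i \<bullet> p)"
    obtain q where q: "norm q = 1" "p \<bullet> q = 0" "\<And>t. v i \<bullet> gc_point p q t = sin (l + t)"
      using meridian[OF p(1) assms(2)[OF iJ] lt1] unfolding l_def by blast
    have "l \<le> arcsin (sin (\<alpha> i))" "arcsin (sin (- \<alpha> i)) \<le> l"
      unfolding l_def using le lt1 \<open>sin (\<alpha> i) < sin (pi / 2)\<close> by (intro arcsin_le_arcsin; auto)+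
    then have "\<bar>l\<bar> \<le> \<alpha> i"
      using al by (subst (asm) (1 2) arcsin_sin) auto
    then have l: "\<bar>l\<bar> \<le> m i * h" using m(1)[OF iJ] by simp
    \<comment> \<open>Rescales the latitude range to the interval from 0 to \<open>m i\<close>,
      where small sphere \<open>j\<close> sits at \<open>j + 1 / 2\<close>, the middle of its unit
      interval.\<close>
    define y where "y = (l / h + m i) / 2"
    have "0 \<le> y" "y \<le> m i"
      using l \<open>h > 0\<close> by (auto simp: y_def field_simps abs_le_iff)
    then obtain j where j: "j < m i" "real j \<le> y" "y \<le> real j + 1"
      using unit_interval_cover[of y "m i"] by (auto simp: m_def)
    define t where "t = \<beta> (i, j) - l"
    have "l = (2 * y - m i) * h"
      using \<open>h > 0\<close> by (simp add: y_def field_simps)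
    then have "t = (2 * (real j - y) + 1) * h"
      by (simp add: t_def \<beta>_def algebra_simps)
    moreover have "\<bar>2 * (real j - y) + 1\<bar> \<le> 1" using j by (simp add: abs_le_iff)
    ultimately have "\<bar>t\<bar> \<le> h"
      using \<open>h > 0\<close> by (simp add: abs_mult)
    then have "\<bar>t\<bar> < pi / (2 * N)" using \<open>h < pi / (2 * N)\<close> by simp
    have "(i, j) \<in> A" using j iJ by (simp add: A_def)
    then have zero: "P (gc_point p q t) = 0"
      unfolding P_def using \<open>finite A\<close> by (intro prod_zero) (auto intro!: bexI[of _ "(i, j)"] simp: q(3) t_def)
    consider "t = 0" | "t > 0" | "t < 0" by linarith
    then show False
    proof cases
      case 1
      then show False using zero \<open>P p \<noteq> 0\<close> by (simp add: gc_point_def)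
    next
      case 2
      then show False using no_zero[OF q(1,2)] zero \<open>\<bar>t\<bar> < pi / (2 * N)\<close> by auto
    next
      case 3
      \<comment> \<open>\<open>no_zero\<close> concerns positive times only, so the circle is run
        backwards.\<close>
      have "gc_point p (- q) (- t) = gc_point p q t" by (simp add: gc_point_def)
      then show False using 3 no_zero[of "- q" "- t"] q zero \<open>\<bar>t\<bar> < pi / (2 * N)\<close> by auto
    qed
  qed
  then show ?thesis using p(1) by blast
qed

section \<open>Zones in terms of unit normals, and coverings of caps\<close>

lemma great_sphere_unit_normal:
  assumes "great_sphere G"
  obtains n where "norm n = 1" "G = sphere 0 1 \<inter> {x. n \<bullet> x = 0}"
proof -
  obtain n where "n \<noteq> 0" "G = sphere 0 1 \<inter> {x. n \<bullet> x = 0}"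
    using assms by (auto simp: great_sphere_def)
  then show thesis
    using that[of "n /\<^sub>R norm n"] by simp
qed

lemma norm_orthogonal_part:
  assumes "norm n = 1" "norm x = 1"
  shows "(norm (x - (n \<bullet> x) *\<^sub>R n))\<^sup>2 = 1 - (n \<bullet> x)\<^sup>2"
proof -
  have "n \<bullet> n = 1" "x \<bullet> x = 1" using assms by (auto simp: norm_eq_1)
  then show ?thesis
    unfolding power2_norm_eq_inner
    by (simp add: inner_simps inner_commute[of x n] power2_eq_square)
qed

text \<open>A unit vector orthogonal to \<open>n\<close> has inner product with \<open>x\<close> at
  most the norm of the part of \<open>x\<close> orthogonal to \<open>n\<close>, whose square is
  \<open>1 - (n \<bullet> x)\<^sup>2\<close>.\<close>

lemma zone_le_sin:
  assumes "norm n = 1" "0 \<le> \<omega>" "\<omega> \<le> pi" "x \<in> zone (sphere 0 1 \<inter> {x. n \<bullet> x = 0}) \<omega>"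
  shows "\<bar>n \<bullet> x\<bar> \<le> sin (\<omega> / 2)"
proof -
  obtain y where xy: "norm x = 1" "norm y = 1" "n \<bullet> y = 0" "arccos (x \<bullet> y) \<le> \<omega> / 2"
    using assms(4) by (auto simp: zone_def sph_dist_def)
  have "\<bar>x \<bullet> y\<bar> \<le> 1" using Cauchy_Schwarz_ineq2[of x y] xy by simp
  then have "cos (\<omega> / 2) \<le> cos (arccos (x \<bullet> y))"
    using xy(4) assms by (intro cos_monotone_0_pi_le arccos_lbound) (auto simp: abs_le_iff)
  also have "\<dots> = x \<bullet> y"
    using \<open>\<bar>x \<bullet> y\<bar> \<le> 1\<close> by (intro cos_arccos_abs)
  also have "\<dots> = (x - (n \<bullet> x) *\<^sub>R n) \<bullet> y"
    using xy(3) by (simp add: inner_simps)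
  also have "\<dots> \<le> norm (x - (n \<bullet> x) *\<^sub>R n)"
    using norm_cauchy_schwarz[of "x - (n \<bullet> x) *\<^sub>R n" y] xy(2) by simp
  finally have "(cos (\<omega> / 2))\<^sup>2 \<le> (norm (x - (n \<bullet> x) *\<^sub>R n))\<^sup>2"
    using assms by (intro power_mono cos_ge_zero) auto
  then have "(n \<bullet> x)\<^sup>2 \<le> (sin (\<omega> / 2))\<^sup>2"
    by (simp add: norm_orthogonal_part[OF assms(1) xy(1)] sin_squared_eq)
  then show ?thesis
    using assms sin_ge_zero[of "\<omega> / 2"] by (simp flip: abs_le_square_iff)
qed

text \<open>The normalized projection of \<open>x\<close> to the hyperplane is close enough;
  \<open>\<omega> < pi\<close> ensures that the projection is nonzero.\<close>

lemma in_zone_if_le_sin: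
  assumes "norm n = 1" "0 \<le> \<omega>" "\<omega> < pi" "norm x = 1" "\<bar>n \<bullet> x\<bar> \<le> sin (\<omega> / 2)"
  shows "x \<in> zone (sphere 0 1 \<inter> {x. n \<bullet> x = 0}) \<omega>"
proof -
  define z where "z = x - (n \<bullet> x) *\<^sub>R n"
  have "cos (\<omega> / 2) > 0" using assms by (intro cos_gt_zero_pi) auto
  have "\<bar>n \<bullet> x\<bar>\<^sup>2 \<le> (sin (\<omega> / 2))\<^sup>2"
    using assms(5) by (intro power_mono) auto
  then have "(cos (\<omega> / 2))\<^sup>2 \<le> (norm z)\<^sup>2"
    by (simp add: z_def norm_orthogonal_part[OF assms(1,4)] cos_squared_eq)
  then have cos_le: "cos (\<omega> / 2) \<le> norm z"
    using power2_le_imp_le by fastforce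
  then have "norm z > 0" using \<open>cos (\<omega> / 2) > 0\<close> by linarith
  have "n \<bullet> n = 1" "x \<bullet> x = 1" using assms by (auto simp: norm_eq_1)
  then have nz: "n \<bullet> z = 0" by (simp add: z_def inner_simps)
  then have "x \<bullet> z = z \<bullet> z" by (simp add: z_def inner_simps inner_commute)
  then have xz: "x \<bullet> (z /\<^sub>R norm z) = norm z"
    using \<open>norm z > 0\<close> by (simp add: dot_square_norm power2_eq_square)
  have "norm z \<le> 1"
    using norm_cauchy_schwarz[of x "z /\<^sub>R norm z"] \<open>norm z > 0\<close> assms(4) unfolding xz by simp
  then have "arccos (norm z) \<le> arccos (cos (\<omega> / 2))"
    using cos_le by (intro arccos_le_arccos) auto
  also have "\<dots> = \<omega> / 2" using assms by (intro arccos_cos) auto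
  finally have "sph_dist x (z /\<^sub>R norm z) \<le> \<omega> / 2" by (simp only: sph_dist_def xz)
  then show ?thesis
    unfolding zone_def using assms(4) nz \<open>norm z > 0\<close>
    by (auto intro!: bexI[of _ "z /\<^sub>R norm z"])
qed

text \<open>Of two antipodal points of \<open>G\<close>, one is at distance at most
  \<open>pi / 2\<close> from \<open>x\<close>; dimension at least 2 makes \<open>G\<close>
  nonempty.\<close>

lemma zone_eq_sphere:
  fixes G :: "'a::euclidean_space set"
  assumes "DIM('a) \<ge> 2" "great_sphere G" "\<omega> \<ge> pi"
  shows "zone G \<omega> = sphere 0 1"
proof -
  obtain n where n: "norm n = 1" "G = sphere 0 1 \<inter> {x. n \<bullet> x = 0}"
    using great_sphere_unit_normal[OF assms(2)] .
  obtain z where z: "z \<noteq> 0" "n \<bullet> z = 0"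
    using orthogonal_to_vector_exists[OF assms(1), of n] by (auto simp: orthogonal_def)
  define y where "y = z /\<^sub>R norm z"
  have y: "norm y = 1" "n \<bullet> y = 0" using z by (auto simp: y_def)
  have "\<exists>y\<in>G. sph_dist x y \<le> \<omega> / 2" if "norm x = 1" for x
  proof -
    define y' where "y' = (if x \<bullet> y \<ge> 0 then y else - y)"
    have "norm y' = 1" "n \<bullet> y' = 0" "x \<bullet> y' \<ge> 0" using y by (auto simp: y'_def)
    moreover have "x \<bullet> y' \<le> 1"
      using norm_cauchy_schwarz[of x y'] \<open>norm y' = 1\<close> that by simp
    ultimately have "y' \<in> G" "arccos (x \<bullet> y') \<le> pi / 2"
      using arccos_le_arccos[of 0 "x \<bullet> y'"] by (auto simp: n(2))
    then show ?thesis
      using assms(3) by (intro bexI[of _ y']) (auto simp: sph_dist_def)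
  qed
  then show ?thesis by (auto simp: zone_def)
qed

text \<open>Enlarging the zones slightly makes them open, so finitely many of them cover the compact
  double cap \<open>\<bar>c \<bullet> x\<bar> \<ge> cos r\<close>. The zone of width \<open>\<pi> - 2 r\<close> around the great sphere
  orthogonal to \<open>c\<close> covers the rest of the sphere.\<close>

lemma cap_covered_by_zones:
  fixes G :: "'i \<Rightarrow> 'a::euclidean_space set"
  assumes "countable I" "\<And>i. i \<in> I \<Longrightarrow> great_sphere (G i)" "\<And>i. i \<in> I \<Longrightarrow> 0 \<le> \<omega> i"
    and sum: "(\<omega> has_sum w) I"
    and "norm c = 1" "0 \<le> r" "r \<le> pi / 2" and cover: "cap c r \<subseteq> (\<Union>i\<in>I. zone (G i) (\<omega> i))"
  shows "2 * r \<le> w"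
proof (rule ccontr)
  assume less: "\<not> 2 * r \<le> w"
  define \<delta> where "\<delta> = (2 * r - w) / 4"
  have "\<delta> > 0" using less by (simp add: \<delta>_def)
  \<comment> \<open>An enumeration of \<open>I\<close> gives the zones geometrically decreasing
    enlargements of total at most \<open>\<delta>\<close>, and
    \<open>w / 2 + \<delta> < r\<close>.\<close>
  define \<alpha> where "\<alpha> i = \<omega> i / 2 + \<delta> * (1 / 2) ^ Suc (to_nat_on I i)" for i
  have "\<exists>n. \<forall>i\<in>I. norm (n i) = 1 \<and> G i = sphere 0 1 \<inter> {x. n i \<bullet> x = 0}"
    using great_sphere_unit_normal[OF assms(2)] by (intro bchoice ballI) metis
  then obtain n where n: "\<And>i. i \<in> I \<Longrightarrow> norm (n i) = 1"
      "\<And>i. i \<in> I \<Longrightarrow> G i = sphere 0 1 \<inter> {x. n i \<bullet> x = 0}"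
    by blast
  have sum_less: "sum \<alpha> J < r" if J: "finite J" "J \<subseteq> I" for J
  proof -
    have "sum \<omega> J \<le> w"
      using J assms(3) by (intro finite_sum_le_has_sum[OF sum]) auto
    moreover have "(\<Sum>i\<in>J. (1 / 2 :: real) ^ Suc (to_nat_on I i)) \<le> 1"
    proof -
      have "inj_on (to_nat_on I) J"
        using inj_on_to_nat_on[OF assms(1)] J(2) by (rule inj_on_subset)
      then have "(\<Sum>i\<in>J. (1 / 2 :: real) ^ Suc (to_nat_on I i)) = (\<Sum>k\<in>to_nat_on I ` J. (1 / 2) ^ Suc k)"
        by (simp add: sum.reindex)
      also have "\<dots> \<le> (\<Sum>k. (1 / 2) ^ Suc k)"
        using J(1) power_half_series by (intro sum_le_suminf) (auto simp: sums_iff)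
      also have "\<dots> = 1" using power_half_series by (simp add: sums_iff)
      finally show ?thesis .
    qed
    then have "\<delta> * (\<Sum>i\<in>J. (1 / 2) ^ Suc (to_nat_on I i)) \<le> \<delta> * 1"
      using \<open>\<delta> > 0\<close> by (intro mult_left_mono) auto
    moreover have "sum \<alpha> J = sum \<omega> J / 2 + \<delta> * (\<Sum>i\<in>J. (1 / 2) ^ Suc (to_nat_on I i))"
      unfolding \<alpha>_def sum.distrib sum_distrib_left sum_divide_distrib ..
    ultimately have "sum \<alpha> J \<le> w / 2 + \<delta>" by simp
    also have "\<dots> < r" using less by (simp add: \<delta>_def field_simps)
    finally show ?thesis .
  qed
  have \<alpha>: "\<alpha> i < pi / 2" "\<omega> i / 2 < \<alpha> i" if "i \<in> I" for i
    using sum_less[of "{i}"] that \<open>r \<le> pi / 2\<close> \<open>\<delta> > 0\<close> by (auto simp: \<alpha>_def)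
  define C where "C = sphere 0 1 \<inter> {x. cos r \<le> \<bar>c \<bullet> x\<bar>}"
  have "compact C"
    unfolding C_def by (intro compact_Int_closed compact_sphere closed_Collect_le continuous_intros)
  moreover have "open {x. \<bar>n i \<bullet> x\<bar> < sin (\<alpha> i)}" for i
    by (intro open_Collect_less continuous_intros)
  moreover have "C \<subseteq> (\<Union>i\<in>I. {x. \<bar>n i \<bullet> x\<bar> < sin (\<alpha> i)})"
  proof
    fix x assume "x \<in> C"
    \<comment> \<open>Passing to the antipode brings \<open>x\<close> into the cap itself and does
      not change \<open>\<bar>n i \<bullet> x\<bar>\<close>.\<close>
    define x' where "x' = (if c \<bullet> x \<ge> 0 then x else - x)"
    have x': "norm x' = 1" "cos r \<le> c \<bullet> x'"
      using \<open>x \<in> C\<close> by (auto simp: C_def x'_def)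
    have "c \<bullet> x' \<le> 1"
      using norm_cauchy_schwarz[of c x'] x'(1) \<open>norm c = 1\<close> by simp
    then have "arccos (c \<bullet> x') \<le> arccos (cos r)"
      using x'(2) by (intro arccos_le_arccos) auto
    also have "\<dots> = r" using assms by (intro arccos_cos) auto
    finally have "x' \<in> cap c r"
      using x'(1) by (simp add: cap_def sph_dist_def)
    from subsetD[OF cover this] obtain i where "i \<in> I" "x' \<in> zone (G i) (\<omega> i)" by blast
    then have i: "i \<in> I" "x' \<in> zone (sphere 0 1 \<inter> {x. n i \<bullet> x = 0}) (\<omega> i)"
      using n(2) by simp_all
    have "\<bar>n i \<bullet> x\<bar> = \<bar>n i \<bullet> x'\<bar>" by (simp add: x'_def)
    also have "\<dots> \<le> sin (\<omega> i / 2)"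
      using n(1) i \<alpha>[OF i(1)] assms(3) by (intro zone_le_sin) auto
    also have "\<dots> < sin (\<alpha> i)"
      using \<alpha>[OF i(1)] assms(3)[OF i(1)] by (intro sin_monotone_2pi) auto
    finally show "x \<in> (\<Union>i\<in>I. {x. \<bar>n i \<bullet> x\<bar> < sin (\<alpha> i)})"
      using i(1) by blast
  qed
  ultimately obtain J where J: "J \<subseteq> I" "finite J" "C \<subseteq> (\<Union>i\<in>J. {x. \<bar>n i \<bullet> x\<bar> < sin (\<alpha> i)})"
    by (rule compactE_image)
  \<comment> \<open>The index \<open>None\<close> stands for the additional zone around the great
    sphere orthogonal to \<open>c\<close>. Its half-width \<open>pi / 2 - r\<close> keeps the total
    below \<open>pi / 2\<close>, and a point that it misses lies in \<open>C\<close>.\<close>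
  define v' where "v' k = (case k of None \<Rightarrow> c | Some i \<Rightarrow> n i)" for k
  define \<alpha>' where "\<alpha>' k = (case k of None \<Rightarrow> pi / 2 - r | Some i \<Rightarrow> \<alpha> i)" for k
  have "\<exists>x. norm x = 1 \<and> (\<forall>k\<in>insert None (Some ` J). sin (\<alpha>' k) < \<bar>v' k \<bullet> x\<bar>)"
  proof (rule finitely_many_zones_miss_point)
    show "sum \<alpha>' (insert None (Some ` J)) < pi / 2"
      using sum_less[OF J(2,1)] J(2) by (simp add: sum.reindex \<alpha>'_def)
    show "0 \<le> \<alpha>' k" if "k \<in> insert None (Some ` J)" for k
      using that J(1) assms(3) \<open>\<delta> > 0\<close> \<open>r \<le> pi / 2\<close> by (auto simp: \<alpha>'_def \<alpha>_def)
    show "norm (v' k) = 1" if "k \<in> insert None (Some ` J)" for k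
      using that J(1) n(1) \<open>norm c = 1\<close> by (auto simp: v'_def)
  qed (use J in auto)
  then obtain x where x: "norm x = 1" "cos r < \<bar>c \<bullet> x\<bar>" "\<And>i. i \<in> J \<Longrightarrow> sin (\<alpha> i) < \<bar>n i \<bullet> x\<bar>"
    by (auto simp: v'_def \<alpha>'_def sin_diff)
  then have "x \<in> C" by (simp add: C_def)
  then show False using J(3) x(3) by force
qed

section \<open>Centrally symmetric convex domains\<close>

text \<open>If \<open>c\<close> is the middle of an arc of length \<open>2 * t \<le> pi\<close> from
  \<open>a\<close> to \<open>b\<close>, then \<open>c \<bullet> a = cos t\<close>, and the double
  angle formulas identify \<open>b\<close> as the reflection of \<open>a\<close> in the line through
  \<open>c\<close>.\<close>

lemma sph_symmetric_about_reflection: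
  assumes "sph_symmetric_about c W" "W \<subseteq> sphere 0 1" "a \<in> W"
  shows "0 \<le> c \<bullet> a" "(2 * (c \<bullet> a)) *\<^sub>R c - a \<in> W"
proof -
  obtain b v where "b \<in> W" and arc: "gc_arc a b v (sph_dist a b)"
    and c: "c = gc_point a v (sph_dist a b / 2)"
    using assms unfolding sph_symmetric_about_def by blast
  define t where "t = sph_dist a b / 2"
  have v: "a \<bullet> a = 1" "v \<bullet> a = 0" and b: "b = gc_point a v (2 * t)" and "t \<ge> 0"
    using arc assms(2,3) by (auto simp: gc_arc_def t_def norm_eq_1 inner_commute)
  have "\<bar>a \<bullet> b\<bar> \<le> 1"
    using Cauchy_Schwarz_ineq2[of a b] subsetD[OF assms(2)] \<open>a \<in> W\<close> \<open>b \<in> W\<close> by force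
  then have "t \<le> pi / 2"
    using arccos_ubound[of "a \<bullet> b"] by (simp add: t_def sph_dist_def abs_le_iff)
  have ca: "c \<bullet> a = cos t" using v by (simp add: c gc_point_def t_def inner_simps)
  then show "0 \<le> c \<bullet> a" using \<open>t \<ge> 0\<close> \<open>t \<le> pi / 2\<close> by (simp add: cos_ge_zero)
  have "(2 * cos t * cos t - 1) *\<^sub>R a + (2 * cos t * sin t) *\<^sub>R v = b"
    unfolding b gc_point_def cos_double_cos sin_double by (simp add: power2_eq_square ac_simps)
  then have "(2 * (c \<bullet> a)) *\<^sub>R c - a = b"
    unfolding ca by (simp add: c gc_point_def algebra_simps flip: t_def)
  with \<open>b \<in> W\<close> show "(2 * (c \<bullet> a)) *\<^sub>R c - a \<in> W" by simp
qed

text \<open>An arc longer than \<open>\<pi>\<close> in the closed hemisphere around \<open>c\<close> lies on its boundary, and then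
  by symmetry the whole great circle is in \<open>W\<close>. So convexity may be used as if the connecting arc
  were always a shortest one.\<close>

lemma sph_convex_cone_add:
  assumes "sph_convex W" "sph_symmetric_about c W" "a \<in> W" "b \<in> W" "0 \<le> s" "0 \<le> t"
  shows "\<exists>R x. 0 \<le> R \<and> x \<in> W \<and> s *\<^sub>R a + t *\<^sub>R b = R *\<^sub>R x"
proof -
  have sub: "W \<subseteq> sphere 0 1" using assms(1) by (simp add: sph_convex_def)
  note refl = sph_symmetric_about_reflection[OF assms(2) sub]
  obtain v l where "gc_arc a b v l" and arc: "gc_point a v ` {0..l} \<subseteq> W"
    using assms unfolding sph_convex_def by blast
  then have l: "0 \<le> l" "l < 2 * pi" and b: "b = gc_point a v l"
    by (auto simp: gc_arc_def)
  \<comment> \<open>Coordinates of the combination in the orthonormal frame \<open>a\<close>,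
    \<open>v\<close>; its direction is then the point of the great circle at angle
    \<open>\<phi>\<close>.\<close>
  define X where "X = s + t * cos l"
  define Y where "Y = t * sin l"
  have XY: "s *\<^sub>R a + t *\<^sub>R b = X *\<^sub>R a + Y *\<^sub>R v"
    by (simp add: b gc_point_def X_def Y_def algebra_simps)
  define R where "R = sqrt (X\<^sup>2 + Y\<^sup>2)"
  show ?thesis
  proof (cases "R = 0")
    case True
    then have "X = 0" "Y = 0" by (auto simp: R_def)
    then show ?thesis using assms(3) by (auto simp: XY intro!: exI[of _ 0] exI[of _ a])
  next
    case False
    then have "R > 0" by (simp add: R_def less_le)
    have "(X / R)\<^sup>2 + (Y / R)\<^sup>2 = (X\<^sup>2 + Y\<^sup>2) / R\<^sup>2"
      by (simp add: power_divide add_divide_distrib)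
    also have "\<dots> = 1" using False by (simp add: R_def)
    finally obtain \<phi> where \<phi>: "0 \<le> \<phi>" "\<phi> < 2 * pi" "X / R = cos \<phi>" "Y / R = sin \<phi>"
      using sincos_total_2pi[of "X / R" "Y / R"] by blast
    have X: "X = R * cos \<phi>" and Y: "Y = R * sin \<phi>"
      using \<open>R > 0\<close> by (simp_all flip: \<phi>(3,4))
    then have eq: "s *\<^sub>R a + t *\<^sub>R b = R *\<^sub>R gc_point a v \<phi>"
      by (simp add: XY gc_point_def algebra_simps)
    have "gc_point a v \<phi> \<in> W"
    proof (cases "l \<le> pi")
      case True
      show ?thesis
      proof (cases "l = 0")
        \<comment> \<open>Separate because for \<open>l = 0\<close> the sign of
          \<open>sin (l - \<phi>)\<close> does not exclude \<open>\<phi> = pi\<close>.\<close>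
        case True
        then have "X = s + t" "Y = 0" by (auto simp: X_def Y_def)
        then have "X = R" using assms by (simp add: R_def)
        then have "cos \<phi> = 1" "sin \<phi> = 0" using X Y \<open>Y = 0\<close> \<open>R > 0\<close> by auto
        then show ?thesis using assms(3) by (simp add: gc_point_def)
      next
        case False
        have "Y \<ge> 0" using assms(6) l True by (simp add: Y_def sin_ge_zero)
        then have "sin \<phi> \<ge> 0" using \<open>R > 0\<close> Y by (simp add: zero_le_mult_iff)
        then have "\<phi> \<le> pi" using \<phi> sin_lt_zero[of \<phi>] by force
        have "R * sin (l - \<phi>) = sin l * X - cos l * Y"
          by (simp add: X Y sin_diff algebra_simps)
        also have "\<dots> = s * sin l"
          by (simp add: X_def Y_def algebra_simps)
        also have "\<dots> \<ge> 0" using assms(5) l True by (simp add: sin_ge_zero)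
        finally have "sin (l - \<phi>) \<ge> 0" using \<open>R > 0\<close> by (simp add: zero_le_mult_iff)
        then have "\<phi> \<le> l"
          using sin_gt_zero[of "\<phi> - l"] \<open>\<phi> \<le> pi\<close> False l sin_minus[of "l - \<phi>"] by force
        then show ?thesis using arc \<phi>(1) by auto
      qed
    next
      case False
      have ge: "0 \<le> c \<bullet> gc_point a v \<tau>" if "0 \<le> \<tau>" "\<tau> \<le> l" for \<tau>
        using arc that by (intro refl(1)) auto
      \<comment> \<open>The arc contains both \<open>a\<close> and its antipode, and neither has a
        negative inner product with \<open>c\<close>.\<close>
      have ca: "c \<bullet> a = 0"
        using ge[of 0] ge[of pi] False l(1) by (simp add: gc_point_def inner_simps)
      have "c \<bullet> v \<ge> 0"
        using ge[of "pi / 2"] False l pi_gt_zero by (simp add: gc_point_def)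
      moreover have "sin l < 0" using False l by (intro sin_lt_zero) auto
      moreover have "sin l * (c \<bullet> v) \<ge> 0"
        using ge[of l] ca l by (simp add: gc_point_def inner_simps)
      ultimately have "c \<bullet> v = 0" by (auto simp: zero_le_mult_iff)
      with ca have perp: "c \<bullet> gc_point a v \<tau> = 0" for \<tau>
        by (simp add: gc_point_def inner_simps)
      show ?thesis
      proof (cases "\<phi> \<le> pi")
        case True
        then show ?thesis using arc \<phi>(1) False by auto
      next
        case \<phi>_gt: False
        \<comment> \<open>On vectors orthogonal to \<open>c\<close> the reflection is the antipodal
          map, so it supplies the rest of the circle.\<close>
        have "gc_point a v (\<phi> - pi) \<in> W"
          using \<phi>_gt \<phi>(2) False arc by auto
        from refl(2)[OF this] show ?thesis
          by (simp add: perp) (simp add: gc_point_def cos_diff sin_diff add.commute)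
      qed
    qed
    with eq \<open>R > 0\<close> show ?thesis by (intro exI[of _ R]) auto
  qed
qed

text \<open>A hyperplane weakly separates \<open>p\<close> from the convex cone over
  \<open>W\<close>. As the cone is invariant under scaling, the separating constant can be replaced
  by 0.\<close>

lemma sph_convex_separation:
  fixes W :: "'a::euclidean_space set"
  assumes "sph_convex W" "sph_symmetric_about c W" "W \<noteq> {}" "norm p = 1" "p \<notin> W"
  obtains n where "n \<noteq> 0" "\<And>x. x \<in> W \<Longrightarrow> 0 \<le> n \<bullet> x" "n \<bullet> p \<le> 0"
proof -
  define K where "K = {t *\<^sub>R x |t x. 0 \<le> t \<and> x \<in> W}"
  have norm1: "norm x = 1" if "x \<in> W" for x
    using assms(1) that by (auto simp: sph_convex_def)
  have "convex K"
  proof (rule convexI)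
    fix x y u v assume "x \<in> K" "y \<in> K" and uv: "0 \<le> u" "0 \<le> v" "u + v = (1::real)"
    then obtain s a t b where "x = s *\<^sub>R a" "y = t *\<^sub>R b" "0 \<le> s" "0 \<le> t" "a \<in> W" "b \<in> W"
      by (auto simp: K_def)
    then show "u *\<^sub>R x + v *\<^sub>R y \<in> K"
      using sph_convex_cone_add[OF assms(1,2), of a b "u * s" "v * t"] uv by (auto simp: K_def)
  qed
  moreover have "K \<noteq> {}" using assms(3) by (force simp: K_def)
  moreover have "p \<notin> K"
    using assms(4,5) norm1 by (auto simp: K_def)
  ultimately obtain a b where ab: "a \<noteq> 0" "\<And>x. x \<in> K \<Longrightarrow> a \<bullet> x \<le> b" "b \<le> a \<bullet> p"
    using separating_hyperplane_sets[of K "{p}"] by auto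
  have K: "t *\<^sub>R x \<in> K" if "0 \<le> t" "x \<in> W" for t x
    using that by (auto simp: K_def)
  obtain x0 where "x0 \<in> W" using assms(3) by blast
  then have "0 \<le> b" using ab(2)[OF K[of 0 x0]] by simp
  have "a \<bullet> x \<le> 0" if "x \<in> W" for x
  proof (rule ccontr)
    assume "\<not> ?thesis"
    then show False
      using ab(2)[OF K[of "(b + 1) / (a \<bullet> x)" x]] that \<open>0 \<le> b\<close> by simp
  qed
  then show thesis
    using that[of "- a"] ab(1,3) \<open>0 \<le> b\<close> by simp
qed

lemma symmetric_in_zone_of_missing_point:
  fixes W :: "'a::euclidean_space set"
  assumes "sph_convex W" "sph_symmetric_about c W" "norm c = 1" "W \<noteq> {}"
    and "0 \<le> \<rho>" "\<rho> < pi / 2" "\<not> cap c \<rho> \<subseteq> W"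
  shows "\<exists>u. norm u = 1 \<and> (\<forall>x\<in>W. \<bar>u \<bullet> x\<bar> \<le> sin \<rho>)"
proof -
  have sub: "W \<subseteq> sphere 0 1" using assms(1) by (simp add: sph_convex_def)
  note refl = sph_symmetric_about_reflection[OF assms(2) sub]
  have "cos \<rho> > 0" "sin \<rho> \<ge> 0"
    using assms by (auto intro: cos_gt_zero_pi sin_ge_zero)
  show ?thesis
  proof (cases "\<exists>x\<in>W. c \<bullet> x > 0")
    case False
    then have "c \<bullet> x = 0" if "x \<in> W" for x using refl(1)[OF that] that by force
    then show ?thesis using \<open>norm c = 1\<close> \<open>sin \<rho> \<ge> 0\<close> by auto
  next
    case True
    then obtain x0 where x0: "x0 \<in> W" "c \<bullet> x0 > 0" by blast
    obtain p where p: "norm p = 1" "p \<notin> W" "arccos (c \<bullet> p) \<le> \<rho>"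
      using assms(7) by (auto simp: cap_def sph_dist_def)
    have "\<bar>c \<bullet> p\<bar> \<le> 1"
      using Cauchy_Schwarz_ineq2[of c p] p(1) \<open>norm c = 1\<close> by simp
    then have "cos \<rho> \<le> cos (arccos (c \<bullet> p))"
      using p(3) assms by (intro cos_monotone_0_pi_le arccos_lbound) (auto simp: abs_le_iff)
    then have cp: "cos \<rho> \<le> c \<bullet> p"
      using \<open>\<bar>c \<bullet> p\<bar> \<le> 1\<close> by (simp add: cos_arccos_abs)
    obtain n where n: "n \<noteq> 0" "\<And>x. x \<in> W \<Longrightarrow> 0 \<le> n \<bullet> x" "n \<bullet> p \<le> 0"
      using sph_convex_separation[OF assms(1,2,4) p(1,2)] by blast
    define \<alpha> where "\<alpha> = n \<bullet> c"
    \<comment> \<open>The part of \<open>n\<close> orthogonal to \<open>c\<close>. Reflection in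
      \<open>c\<close> reverses its sign, so the inequality for \<open>n\<close> and its mirror
      image confine \<open>W\<close> to the wedge
      \<open>\<bar>m \<bullet> x\<bar> \<le> \<alpha> * (c \<bullet> x)\<close>.\<close>
    define m where "m = n - \<alpha> *\<^sub>R c"
    have "c \<bullet> c = 1" using \<open>norm c = 1\<close> by (simp add: norm_eq_1)
    then have "m \<bullet> c = 0" by (simp add: m_def inner_simps \<alpha>_def)
    have n_inner: "n \<bullet> x = \<alpha> * (c \<bullet> x) + m \<bullet> x" for x
      by (simp add: m_def inner_simps)
    have mx: "\<bar>m \<bullet> x\<bar> \<le> \<alpha> * (c \<bullet> x)" if "x \<in> W" for x
    proof -
      have "0 \<le> n \<bullet> ((2 * (c \<bullet> x)) *\<^sub>R c - x)"
        using n(2) refl(2)[OF that] by blast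
      also have "\<dots> = \<alpha> * (c \<bullet> x) - m \<bullet> x"
        by (simp add: inner_diff_right n_inner[of x] flip: \<alpha>_def)
      finally show ?thesis using n(2)[OF that] by (simp add: n_inner abs_le_iff)
    qed
    have "\<alpha> \<ge> 0"
      using order_trans[OF abs_ge_zero mx[OF x0(1)]] x0(2) by (simp add: zero_le_mult_iff)
    \<comment> \<open>Since \<open>p\<close> is within \<open>\<rho>\<close> of \<open>c\<close> but
      not strictly on the side of \<open>W\<close>, the half-angle of the wedge is at most
      \<open>\<rho>\<close>.\<close>
    have "\<alpha> * cos \<rho> \<le> \<alpha> * (c \<bullet> p)" using cp \<open>\<alpha> \<ge> 0\<close> by (rule mult_left_mono)
    also have "\<dots> \<le> (- m) \<bullet> (p - (c \<bullet> p) *\<^sub>R c)"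
      using n(3) \<open>m \<bullet> c = 0\<close> by (simp add: n_inner inner_simps)
    also have "\<dots> \<le> norm m * norm (p - (c \<bullet> p) *\<^sub>R c)"
      using norm_cauchy_schwarz[of "- m"] by simp
    also have "\<dots> \<le> norm m * sin \<rho>"
    proof (rule mult_left_mono[OF power2_le_imp_le])
      have "(cos \<rho>)\<^sup>2 \<le> (c \<bullet> p)\<^sup>2"
        using cp \<open>cos \<rho> > 0\<close> by (intro power_mono) auto
      then show "(norm (p - (c \<bullet> p) *\<^sub>R c))\<^sup>2 \<le> (sin \<rho>)\<^sup>2"
        by (simp add: norm_orthogonal_part[OF \<open>norm c = 1\<close> p(1)] sin_squared_eq)
    qed (use \<open>sin \<rho> \<ge> 0\<close> in auto)
    finally have slope: "\<alpha> * cos \<rho> \<le> norm m * sin \<rho>" .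
    have "m \<noteq> 0"
    proof
      assume "m = 0"
      then have "\<alpha> = 0" using slope \<open>cos \<rho> > 0\<close> \<open>\<alpha> \<ge> 0\<close> by (simp add: mult_le_0_iff)
      then show False using \<open>m = 0\<close> n(1) by (simp add: m_def)
    qed
    define u where "u = m /\<^sub>R norm m"
    have u: "norm u = 1" "u \<bullet> c = 0" using \<open>m \<noteq> 0\<close> \<open>m \<bullet> c = 0\<close> by (auto simp: u_def)
    have "\<bar>u \<bullet> x\<bar> \<le> sin \<rho>" if "x \<in> W" for x
    proof -
      have "norm x = 1" using sub that by auto
      have "norm m * (\<bar>u \<bullet> x\<bar> * cos \<rho>) = \<bar>m \<bullet> x\<bar> * cos \<rho>"
        using \<open>m \<noteq> 0\<close> by (simp add: u_def abs_mult)
      also have "\<dots> \<le> \<alpha> * (c \<bullet> x) * cos \<rho>"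
        using mx[OF that] \<open>cos \<rho> > 0\<close> by (intro mult_right_mono) auto
      also have "\<dots> \<le> norm m * sin \<rho> * (c \<bullet> x)"
        using mult_right_mono[OF slope refl(1)[OF that]] by (simp add: ac_simps)
      finally have "\<bar>u \<bullet> x\<bar> * cos \<rho> \<le> sin \<rho> * (c \<bullet> x)"
        using \<open>m \<noteq> 0\<close> by simp
      then have "(\<bar>u \<bullet> x\<bar> * cos \<rho>)\<^sup>2 \<le> (sin \<rho> * (c \<bullet> x))\<^sup>2"
        using \<open>cos \<rho> > 0\<close> by (intro power_mono) auto
      then have "(u \<bullet> x)\<^sup>2 * (1 - (sin \<rho>)\<^sup>2) \<le> (sin \<rho>)\<^sup>2 * (c \<bullet> x)\<^sup>2"
        by (simp add: power_mult_distrib cos_squared_eq)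
      \<comment> \<open>Bessel's inequality for the orthonormal vectors \<open>u\<close> and
        \<open>c\<close>.\<close>
      also have "\<dots> \<le> (sin \<rho>)\<^sup>2 * (1 - (u \<bullet> x)\<^sup>2)"
      proof -
        have "c \<bullet> x = c \<bullet> (x - (u \<bullet> x) *\<^sub>R u)"
          using u(2) by (simp add: inner_simps inner_commute)
        then have "\<bar>c \<bullet> x\<bar> \<le> norm (x - (u \<bullet> x) *\<^sub>R u)"
          using Cauchy_Schwarz_ineq2[of c "x - (u \<bullet> x) *\<^sub>R u"] \<open>norm c = 1\<close> by simp
        then have "\<bar>c \<bullet> x\<bar>\<^sup>2 \<le> 1 - (u \<bullet> x)\<^sup>2"
          unfolding norm_orthogonal_part[OF u(1) \<open>norm x = 1\<close>, symmetric] by (intro power_mono) auto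
        then show ?thesis by (intro mult_left_mono) auto
      qed
      finally have "(u \<bullet> x)\<^sup>2 \<le> (sin \<rho>)\<^sup>2" by (simp add: algebra_simps)
      then show ?thesis using \<open>sin \<rho> \<ge> 0\<close> by (simp flip: abs_le_square_iff)
    qed
    then show ?thesis using u(1) by blast
  qed
qed

text \<open>Only caps of radius greater than \<open>r\<close> are known to be missing, so a unit
  normal is taken as a limit, by compactness of the sphere, of those for radii decreasing to
  \<open>r\<close>.\<close>

lemma symmetric_in_zone_of_missing_points:
  fixes W :: "'a::euclidean_space set"
  assumes "sph_convex W" "sph_symmetric_about c W" "norm c = 1" "0 \<le> r" "r < pi / 2"
    and missing: "\<And>\<rho>. r < \<rho> \<Longrightarrow> \<rho> < pi / 2 \<Longrightarrow> \<not> cap c \<rho> \<subseteq> W"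
  shows "\<exists>u. norm u = 1 \<and> (\<forall>x\<in>W. \<bar>u \<bullet> x\<bar> \<le> sin r)"
proof (cases "W = {}")
  case True
  then show ?thesis using assms(3) by blast
next
  case False
  \<comment> \<open>The shift by 2 keeps even the first radius strictly below
    \<open>pi / 2\<close>.\<close>
  define \<rho> where "\<rho> k = r + (pi / 2 - r) / real (k + 2)" for k :: nat
  have \<rho>: "r < \<rho> k" "\<rho> k < pi / 2" for k
  proof -
    have "(pi / 2 - r) / real (k + 2) < (pi / 2 - r) / 1"
      using assms(5) by (intro divide_strict_left_mono) auto
    then have "(pi / 2 - r) / real (k + 2) < pi / 2 - r"
      by (simp only: div_by_1)
    moreover have "(pi / 2 - r) / real (k + 2) > 0" using assms(5) by simp
    ultimately show "r < \<rho> k" "\<rho> k < pi / 2"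
      unfolding \<rho>_def by linarith+
  qed
  have "\<exists>u. norm u = 1 \<and> (\<forall>x\<in>W. \<bar>u \<bullet> x\<bar> \<le> sin (\<rho> k))" for k
    using assms \<rho>[of k] False by (intro symmetric_in_zone_of_missing_point missing) auto
  then obtain u where u: "\<And>k. norm (u k) = 1" "\<And>k x. x \<in> W \<Longrightarrow> \<bar>u k \<bullet> x\<bar> \<le> sin (\<rho> k)"
    by metis
  then obtain l f where l: "l \<in> sphere 0 1" "strict_mono f" "(u \<circ> f) \<longlonglongrightarrow> l"
    using compact_sphere[of 0 1, unfolded compact_def] by (metis mem_sphere_0)
  have "(\<lambda>k. (pi / 2 - r) / real (k + 2)) \<longlonglongrightarrow> 0"
    by (intro LIMSEQ_ignore_initial_segment lim_const_over_n)
  from tendsto_add[OF tendsto_const[of r] this] have "\<rho> \<longlonglongrightarrow> r"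
    by (simp add: \<rho>_def[abs_def])
  then have "(\<lambda>k. sin (\<rho> (f k))) \<longlonglongrightarrow> sin r"
    using LIMSEQ_subseq_LIMSEQ[OF _ l(2), of \<rho> r] by (intro tendsto_sin) (simp add: o_def)
  then have "\<bar>l \<bullet> x\<bar> \<le> sin r" if "x \<in> W" for x
  proof (rule LIMSEQ_le[rotated])
    show "(\<lambda>k. \<bar>u (f k) \<bullet> x\<bar>) \<longlonglongrightarrow> \<bar>l \<bullet> x\<bar>"
      using l(3) by (intro tendsto_intros) (simp add: o_def)
  qed (use u(2)[OF that] in auto)
  then show ?thesis using l(1) by auto
qed

theorem corollary8:
  fixes d :: nat
    and I :: "'i set"
    and G :: "'i \<Rightarrow> 'a::euclidean_space set"
    and \<omega> :: "'i \<Rightarrow> real"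
    and w :: real
  assumes "d \<ge> 1"
    and "DIM('a) = d + 1"
    and "countable I"
    and "\<And>i. i \<in> I \<Longrightarrow> great_sphere (G i)"
    and "\<And>i. i \<in> I \<Longrightarrow> 0 \<le> \<omega> i"
    and "(\<omega> has_sum w) I"
  shows "(\<forall>W. sph_convex W \<and> sph_centrally_symmetric W \<and> W \<subseteq> (\<Union>i\<in>I. zone (G i) (\<omega> i))
            \<longrightarrow> (\<exists>H. great_sphere H \<and> W \<subseteq> zone H w)) \<and>
         (\<forall>c r. c \<in> sphere 0 1 \<and> 0 \<le> r \<and> r \<le> pi / 2 \<and> cap c r \<subseteq> (\<Union>i\<in>I. zone (G i) (\<omega> i))
            \<longrightarrow> 2 * r \<le> w)"
proof (rule conjI; intro allI impI; elim conjE)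
  fix c :: 'a and r
  assume "c \<in> sphere 0 1" "0 \<le> r" "r \<le> pi / 2" "cap c r \<subseteq> (\<Union>i\<in>I. zone (G i) (\<omega> i))"
  then show "2 * r \<le> w"
    using cap_covered_by_zones[where G = G, OF assms(3-6)] by auto
next
  fix W :: "'a set"
  assume W: "sph_convex W" "sph_centrally_symmetric W" "W \<subseteq> (\<Union>i\<in>I. zone (G i) (\<omega> i))"
  have sub: "W \<subseteq> sphere 0 1" using W(1) by (simp add: sph_convex_def)
  have great: "great_sphere (sphere 0 1 \<inter> {x. u \<bullet> x = 0})" if "norm u = 1" for u :: 'a
    using that unfolding great_sphere_def by (intro exI[of _ u]) auto
  obtain c where c: "norm c = 1" "sph_symmetric_about c W"
    using W(2) by (auto simp: sph_centrally_symmetric_def)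
  have "0 \<le> w" using has_sum_nonneg[OF assms(6)] assms(5) by blast
  show "\<exists>H. great_sphere H \<and> W \<subseteq> zone H w"
  proof (cases "w < pi")
    case False
    then show ?thesis
      using great[OF c(1)] zone_eq_sphere[OF _ great[OF c(1)], of w] sub assms(1,2) by auto
  next
    case True
    \<comment> \<open>A cap inside \<open>W\<close> is covered by the zones, so its radius is at
      most \<open>w / 2\<close>.\<close>
    have "\<not> cap c \<rho> \<subseteq> W" if "w / 2 < \<rho>" "\<rho> < pi / 2" for \<rho>
      using cap_covered_by_zones[where G = G, OF assms(3-6) c(1), of \<rho>] that W(3) \<open>0 \<le> w\<close> by auto
    then obtain u where u: "norm u = 1" "\<And>x. x \<in> W \<Longrightarrow> \<bar>u \<bullet> x\<bar> \<le> sin (w / 2)"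
      using symmetric_in_zone_of_missing_points[OF W(1) c(2,1), of "w / 2"] \<open>0 \<le> w\<close> True by auto
    have "W \<subseteq> zone (sphere 0 1 \<inter> {x. u \<bullet> x = 0}) w"
      using u sub \<open>0 \<le> w\<close> True by (auto intro!: in_zone_if_le_sin)
    then show ?thesis using great[OF u(1)] by blast
  qed
qed

end
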